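(* Let $\tilde{\lambda}_4=\lambda_0^-(2_2\,1_2\,2_8\,1_2\,2_8\,1_2\,2^*\,2_8\,1_2\,2_{10})$. Up to transposition, a $(4,\tilde{\lambda}_4)$-admissible word $\theta$ has the form $$\theta=\dots 2_8\,1_2\,2_{10}\,1_2\,2_8\,1_2\,2^*\,2_8\,1_2\,2_{10}\,1_2\,2_8\,1_2\,2_2\dots$$ In particular, it contains the string $\theta_4^0=2_8\,1_2\,2_{10}\,1_2\,2_8\,1_2\,2^*\,2_8\,1_2\,2_{10}\,1_2\,2_8\,1$.
   Context: All words are over the alphabet $\{1,2\}$. Subscripts indicate repetition of a character (e.g. $1_2 2_4$ is $112222$), and an asterisk marks the entry in position $0$; writing $\theta=\dots u\dots$ means that $\theta$ contains the string $u$ with its starred entry at position $0$. For $\theta=(a_n)_{n\in\mathbb{Z}}\in\{1,2\}^{\mathbb{Z}}$ put $\lambda_i(\theta)=[a_i;a_{i+1},a_{i+2},\dots]+[0;a_{i-1},a_{i-2},\dots]$ and $m(\theta)=\sup_{i\in\mathbb{Z}}\lambda_i(\theta)$. For a finite string $u=(a_i)_{i=-m}^{n}$ put $\lambda_0^-(u)=\min\{[a_0;a_1,\dots,a_n,\theta_1]+[0;a_{-1},\dots,a_{-m},\theta_2]:\theta_1,\theta_2\in\{1,2\}^{\mathbb{N}}\}$. For $k\ge1$ let $\underline{\omega}_k=2_{2k}\,1_2\,2_{2k+1}\,1_2\,2_{2k+2}\,1_2$ and let $\theta(\underline{\omega}_k)$ be the bi-infinite periodic word obtained by repeating $\underline{\omega}_k$.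 A word $\theta\in\{1,2\}^{\mathbb{Z}}$ is $(k,\lambda)$-admissible if $m(\theta(\underline{\omega}_k))<m(\theta)=\lambda_0(\theta)<\lambda$. The transposition of $\theta=(a_n)_{n\in\mathbb{Z}}$ is $(a_{-n})_{n\in\mathbb{Z}}$; "up to transposition" means that $\theta$ or its transposition has the stated form. *)

theory Defs
  imports Complex_Main "HOL-Library.Omega_Words_Fun"
begin

text \<open>
  Bi-infinite words are functions \<open>int \<Rightarrow> nat\<close>, one-sided infinite words are functions
  \<open>nat \<Rightarrow> nat\<close> (with \<open>u \<frown> w\<close> prepending the list \<open>u\<close> to \<open>w\<close>).  A finite word with a starred
  entry is given by two lists: the letters strictly to the left of position 0, and the letters
  from position 0 onwards; both are listed from left to right, so the starred entry is the head
  of the second list.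
\<close>

primrec convergent_cf :: "nat \<Rightarrow> (nat \<Rightarrow> nat) \<Rightarrow> real" where
  "convergent_cf 0 a = real (a 0)"
| "convergent_cf (Suc n) a = real (a 0) + 1 / convergent_cf n (\<lambda>i. a (Suc i))"

definition cf :: "(nat \<Rightarrow> nat) \<Rightarrow> real" where
  "cf a = lim (\<lambda>n. convergent_cf n a)"

definition lambda_at :: "int \<Rightarrow> (int \<Rightarrow> nat) \<Rightarrow> real" where
  "lambda_at i \<theta> =
     cf (\<lambda>n. \<theta> (i + int n)) + cf ([0] \<frown> (\<lambda>n. \<theta> (i - 1 - int n)))"

definition markov_value :: "(int \<Rightarrow> nat) \<Rightarrow> real" where
  "markov_value \<theta> = (SUP i. lambda_at i \<theta>)"

text \<open>
  The infimum below is a minimum when the words have letters in \<open>{1, 2}\<close> and \<open>r\<close> is nonempty: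
  the expression is continuous in \<open>(\<theta>\<^sub>1, \<theta>\<^sub>2)\<close>, which ranges over a compact space.
\<close>

definition lambda0_minus :: "nat list \<Rightarrow> nat list \<Rightarrow> real" where
  "lambda0_minus l r =
     Inf {cf (r \<frown> \<theta>\<^sub>1) + cf ((0 # rev l) \<frown> \<theta>\<^sub>2) | \<theta>\<^sub>1 \<theta>\<^sub>2.
            range \<theta>\<^sub>1 \<subseteq> {1, 2} \<and> range \<theta>\<^sub>2 \<subseteq> {1, 2}}"

definition periodic_word :: "nat list \<Rightarrow> int \<Rightarrow> nat" where
  "periodic_word w i = w ! nat (i mod int (length w))"

text \<open>\<open>blocks [(2, 8), (1, 2)]\<close> is the word $2_8 1_2$.\<close>

definition blocks :: "(nat \<times> nat) list \<Rightarrow> nat list" where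
  "blocks bs = concat (map (\<lambda>(c, n). replicate n c) bs)"

definition omega_word :: "nat \<Rightarrow> nat list" where
  "omega_word k = blocks [(2, 2*k), (1, 2), (2, 2*k + 1), (1, 2), (2, 2*k + 2), (1, 2)]"

definition admissible :: "nat \<Rightarrow> real \<Rightarrow> (int \<Rightarrow> nat) \<Rightarrow> bool" where
  "admissible k \<Lambda> \<theta> \<longleftrightarrow>
     range \<theta> \<subseteq> {1, 2} \<and>
     markov_value (periodic_word (omega_word k)) < markov_value \<theta> \<and>
     markov_value \<theta> = lambda_at 0 \<theta> \<and>
     lambda_at 0 \<theta> < \<Lambda>"

definition transposition :: "(int \<Rightarrow> nat) \<Rightarrow> int \<Rightarrow> nat" where
  "transposition \<theta> n = \<theta> (- n)"

definition contains_starred :: "(int \<Rightarrow> nat) \<Rightarrow> nat list \<Rightarrow> nat list \<Rightarrow> bool" where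
  "contains_starred \<theta> l r \<longleftrightarrow>
     (\<forall>j < length (l @ r). \<theta> (int j - int (length l)) = (l @ r) ! j)"

definition lambda_tilde_4 :: real where
  "lambda_tilde_4 =
     lambda0_minus (blocks [(2, 2), (1, 2), (2, 8), (1, 2), (2, 8), (1, 2)])
                   (blocks [(2, 1), (2, 8), (1, 2), (2, 10)])"

end

theory Submission
  imports Defs
begin

text \<open>
  The two thresholds differ by about \<open>1.8 * 10 ^ -15\<close>. Both are replaced by decimal bounds, and
  all words around position \<open>0\<close> are enumerated in a binary tree, each node extending the known
  window by one letter on one side. A branch ends when every word with the given window
  has \<open>lambda_at 0\<close> below the lower threshold or some \<open>lambda_at i\<close> above the upper one; exact
  comparison with \<open>lambda_tilde_4\<close> is needed only for the window that defines it. Transposition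
  reduces the search to words with \<open>1\<close> at position \<open>-1\<close> and \<open>2\<close> at positions \<open>0\<close> and \<open>1\<close>, and
  then a single branch survives.
\<close>

section \<open>Continued fractions with partial quotients 1 and 2\<close>

lemma convergent_cf_bounds:
  assumes "range x \<subseteq> {1, 2}"
  shows "1 \<le> convergent_cf n x \<and> convergent_cf n x \<le> 3"
  using assms
proof (induction n arbitrary: x)
  case 0
  then have "x 0 \<in> {1, 2}" by blast
  then show ?case by auto
next
  case (Suc n)
  then have "x 0 \<in> {1, 2}" and "range (\<lambda>i. x (Suc i)) \<subseteq> {1, 2}" by blast+
  moreover from this Suc.IH have "1 \<le> convergent_cf n (\<lambda>i. x (Suc i))" by blast
  ultimately show ?case by (auto simp: field_simps)
qed

lemma convergent_cf_ge_4_3: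
  assumes "range x \<subseteq> {1, 2}"
  shows "4 / 3 \<le> convergent_cf (Suc n) x"
proof -
  have "x 0 \<in> {1, 2}" and "range (\<lambda>i. x (Suc i)) \<subseteq> {1, 2}"
    using assms by blast+
  moreover from this convergent_cf_bounds
  have "1 \<le> convergent_cf n (\<lambda>i. x (Suc i))" "convergent_cf n (\<lambda>i. x (Suc i)) \<le> 3" by blast+
  ultimately show ?thesis by (auto simp: field_simps)
qed

text \<open>Prepending a letter turns the gap \<open>v - u\<close> between two convergents into
  \<open>(v - u) / (u * v)\<close>. As \<open>u\<close> has depth at least one, \<open>u * v\<close>
  is at least 4/3, so each level contracts by 3/4.\<close>

lemma convergent_cf_diff:
  assumes "range x \<subseteq> {1, 2}"
  shows "\<bar>convergent_cf (Suc n) x - convergent_cf n x\<bar> \<le> (3 / 4) ^ n"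
  using assms
proof (induction n arbitrary: x)
  case 0
  then have "1 \<le> x (Suc 0)" by (metis insert_iff order_refl one_le_numeral rangeI singletonD subsetD)
  then show ?case by (simp add: field_simps)
next
  case (Suc n)
  let ?y = "\<lambda>i. x (Suc i)"
  let ?u = "convergent_cf (Suc n) ?y" and ?v = "convergent_cf n ?y"
  have y: "range ?y \<subseteq> {1, 2}" using Suc.prems by blast
  have u: "4 / 3 \<le> ?u" and v: "1 \<le> ?v"
    using convergent_cf_ge_4_3[OF y] convergent_cf_bounds[OF y] by blast+
  have "convergent_cf (Suc (Suc n)) x - convergent_cf (Suc n) x = (?v - ?u) / (?u * ?v)"
    unfolding convergent_cf.simps(2)[of "Suc n" x] convergent_cf.simps(2)[of n x]
    using u v by (simp add: field_simps del: convergent_cf.simps)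
  moreover have "4 / 3 * 1 \<le> ?u * ?v"
    using u v by (intro mult_mono) auto
  then have "\<bar>?v - ?u\<bar> / (?u * ?v) \<le> (3 / 4) ^ n / (4 / 3)"
    using Suc.IH[OF y] by (intro frac_le) (auto simp: abs_minus_commute)
  ultimately show ?case
    using u v by (simp add: abs_mult del: convergent_cf.simps)
qed

text \<open>\<open>cf\<close> is defined by \<open>lim\<close>, which carries information only once
  convergence is known. The increments are dominated by a geometric series and telescope.\<close>

lemma convergent_cf_tendsto:
  assumes "range x \<subseteq> {1, 2}"
  shows "(\<lambda>n. convergent_cf n x) \<longlonglongrightarrow> cf x"
proof -
  have "summable (\<lambda>n. convergent_cf (Suc n) x - convergent_cf n x)"
    by (rule summable_comparison_test'[where g = "\<lambda>n. (3 / 4) ^ n" and N = 0])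
      (use convergent_cf_diff[OF assms] in \<open>auto simp del: convergent_cf.simps\<close>)
  then have "(\<lambda>n. \<Sum>k<n. convergent_cf (Suc k) x - convergent_cf k x) \<longlonglongrightarrow>
      (\<Sum>k. convergent_cf (Suc k) x - convergent_cf k x)"
    by (rule summable_LIMSEQ)
  then have "(\<lambda>n. convergent_cf n x - convergent_cf 0 x) \<longlonglongrightarrow>
      (\<Sum>k. convergent_cf (Suc k) x - convergent_cf k x)"
    by (simp only: sum_lessThan_telescope[where f = "\<lambda>n. convergent_cf n x"])
  from tendsto_add[OF this tendsto_const[of "convergent_cf 0 x"]]
  have "convergent (\<lambda>n. convergent_cf n x)"
    by (auto simp: convergent_def)
  then show ?thesis
    by (simp add: cf_def convergent_LIMSEQ_iff)
qed

lemma cf_bounds: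
  assumes "range x \<subseteq> {1, 2}"
  shows "1 \<le> cf x" "cf x \<le> 3"
  using convergent_cf_bounds[OF assms]
  by (auto intro: LIMSEQ_le_const[OF convergent_cf_tendsto[OF assms]]
      LIMSEQ_le_const2[OF convergent_cf_tendsto[OF assms]])

text \<open>Only the tail is restricted to 1 and 2, so that the head may also be the 0 in front of
  the left half of \<open>lambda_at\<close>.\<close>

lemma cf_unfold:
  assumes "range (\<lambda>i. x (Suc i)) \<subseteq> {1, 2}"
  shows "cf x = real (x 0) + 1 / cf (\<lambda>i. x (Suc i))"
proof -
  have "(\<lambda>n. real (x 0) + 1 / convergent_cf n (\<lambda>i. x (Suc i)))
      \<longlonglongrightarrow> real (x 0) + 1 / cf (\<lambda>i. x (Suc i))"
    using cf_bounds[OF assms] by (intro tendsto_intros convergent_cf_tendsto assms) simp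
  then have "(\<lambda>n. convergent_cf (Suc n) x) \<longlonglongrightarrow> real (x 0) + 1 / cf (\<lambda>i. x (Suc i))"
    by simp
  then have "(\<lambda>n. convergent_cf n x) \<longlonglongrightarrow> real (x 0) + 1 / cf (\<lambda>i. x (Suc i))"
    by (rule LIMSEQ_imp_Suc)
  then show ?thesis
    by (simp add: cf_def limI)
qed

lemma cf_0_conc:
  assumes "range x \<subseteq> {1, 2}"
  shows "cf ([0] \<frown> x) = 1 / cf x"
proof -
  have "(\<lambda>i. ([0] \<frown> x) (Suc i)) = x" by (simp add: conc_def)
  then show ?thesis
    using cf_unfold[of "[0] \<frown> x"] assms by (simp add: conc_def)
qed

section \<open>Rational bounds on cylinders\<close>

text \<open>Fractions are numerator--denominator pairs, so that all comparisons below are between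
  integers. The unknown tail after \<open>w\<close> ranges over \<open>[1, 3]\<close>.\<close>

fun cf_bound :: "bool \<Rightarrow> nat list \<Rightarrow> int \<times> int" where
  "cf_bound upper [] = (if upper then 3 else 1, 1)"
| "cf_bound upper (a # w) = (case cf_bound (\<not> upper) w of (p, q) \<Rightarrow> (int a * p + q, p))"

lemma cf_bound_pos:
  assumes "set w \<subseteq> {1, 2}"
  shows "0 < fst (cf_bound u w) \<and> 0 < snd (cf_bound u w)"
  using assms
proof (induction w arbitrary: u)
  case (Cons a w)
  then have "0 < fst (cf_bound (\<not> u) w)" "0 < snd (cf_bound (\<not> u) w)" by simp_all
  moreover have "1 \<le> a" using Cons.prems by auto
  ultimately show ?case
    by (auto simp: split_beta intro!: add_pos_pos)
qed auto

lemma set_subset_if_nth: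
  assumes "range x \<subseteq> A" and "\<And>j. j < length w \<Longrightarrow> x j = w ! j"
  shows "set w \<subseteq> A"
proof
  fix a assume "a \<in> set w"
  then obtain j where "j < length w" "a = w ! j" by (metis in_set_conv_nth)
  then have "a = x j" using assms(2) by simp
  then show "a \<in> A" using assms(1) by blast
qed

text \<open>For positive t the map a + 1/t is decreasing, so an upper bound on the tail gives a
  lower bound on the whole word and conversely. This is why the flag of \<open>cf_bound\<close>
  alternates.\<close>

lemma cf_between:
  assumes "range x \<subseteq> {1, 2}" and "\<And>j. j < length w \<Longrightarrow> x j = w ! j"
  shows "fst (cf_bound False w) / snd (cf_bound False w) \<le> cf x"
    and "cf x \<le> fst (cf_bound True w) / snd (cf_bound True w)"
proof -
  have "fst (cf_bound False w) / snd (cf_bound False w) \<le> cf x \<and>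
      cf x \<le> fst (cf_bound True w) / snd (cf_bound True w)"
    using assms
  proof (induction w arbitrary: x)
    case Nil
    then show ?case using cf_bounds by simp
  next
    case (Cons a w)
    let ?y = "\<lambda>i. x (Suc i)"
    have y: "range ?y \<subseteq> {1, 2}" using Cons.prems(1) by blast
    have a: "x 0 = a" using Cons.prems(2)[of 0] by simp
    have nth: "?y j = w ! j" if "j < length w" for j
      using Cons.prems(2)[of "Suc j"] that by simp
    have "set w \<subseteq> {1, 2}"
      by (rule set_subset_if_nth[OF y nth])
    then have pos: "0 < fst (cf_bound u w)" "0 < snd (cf_bound u w)" for u
      using cf_bound_pos by blast+
    have bnd: "fst (cf_bound u (a # w)) / snd (cf_bound u (a # w)) =
        real a + 1 / (fst (cf_bound (\<not> u) w) / snd (cf_bound (\<not> u) w))" for u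
      using pos[of "\<not> u"] by (simp add: split_beta field_simps)
    have "fst (cf_bound False w) / snd (cf_bound False w) \<le> cf ?y"
      and "cf ?y \<le> fst (cf_bound True w) / snd (cf_bound True w)"
      using Cons.IH[OF y nth] by blast+
    moreover have "0 < cf ?y" using cf_bounds(1)[OF y] by linarith
    moreover have "0 < real_of_int (fst (cf_bound u w)) / snd (cf_bound u w)" for u
      using pos by simp
    ultimately have "1 / (fst (cf_bound True w) / snd (cf_bound True w)) \<le> 1 / cf ?y"
      and "1 / cf ?y \<le> 1 / (fst (cf_bound False w) / snd (cf_bound False w))"
      by (intro divide_left_mono mult_pos_pos; simp)+
    then show ?case
      by (simp add: bnd cf_unfold[OF y] a del: cf_bound.simps divide_divide_eq_right)
  qed
  then show "fst (cf_bound False w) / snd (cf_bound False w) \<le> cf x"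
    and "cf x \<le> fst (cf_bound True w) / snd (cf_bound True w)" by blast+
qed

text \<open>Here \<open>l\<close> lists the letters to the left of the centre, nearest first.\<close>

definition lambda_bound :: "bool \<Rightarrow> nat list \<Rightarrow> nat list \<Rightarrow> int \<times> int" where
  "lambda_bound upper l r =
     (case cf_bound upper r of (p, q) \<Rightarrow> case cf_bound (\<not> upper) l of (p', q') \<Rightarrow>
       (p * p' + q * q', q * p'))"

text \<open>The left half enters as a reciprocal, so its opposite bound is the one that
  contributes.\<close>

lemma lambda_bound_eq:
  assumes "set l \<subseteq> {1, 2}" "set r \<subseteq> {1, 2}"
  shows "0 < snd (lambda_bound u l r)"
    and "fst (lambda_bound u l r) / snd (lambda_bound u l r) =
      fst (cf_bound u r) / snd (cf_bound u r) +
      1 / (fst (cf_bound (\<not> u) l) / snd (cf_bound (\<not> u) l))"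
  using cf_bound_pos[OF assms(1), of "\<not> u"] cf_bound_pos[OF assms(2), of u]
  by (auto simp: lambda_bound_def split_beta field_simps)

text \<open>Denominators are multiplied out so that the bounds chain directly with integer
  comparisons decided by evaluation.\<close>

lemma cf_sum_between:
  assumes x: "range x \<subseteq> {1, 2}" "\<And>j. j < length r \<Longrightarrow> x j = r ! j"
    and y: "range y \<subseteq> {1, 2}" "\<And>j. j < length l \<Longrightarrow> y j = l ! j"
  shows "fst (lambda_bound False l r) \<le> (cf x + cf ([0] \<frown> y)) * snd (lambda_bound False l r)"
    and "(cf x + cf ([0] \<frown> y)) * snd (lambda_bound True l r) \<le> fst (lambda_bound True l r)"
proof -
  have l: "set l \<subseteq> {1, 2}" by (rule set_subset_if_nth[OF y])
  have r: "set r \<subseteq> {1, 2}" by (rule set_subset_if_nth[OF x])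
  have y1: "1 \<le> cf y" using cf_bounds[OF y(1)] by blast
  have pos: "0 < fst (cf_bound u l) / snd (cf_bound u l)" for u
    using cf_bound_pos[OF l, of u] by simp
  have "1 / (fst (cf_bound True l) / snd (cf_bound True l)) \<le> 1 / cf y"
    using cf_between(2)[OF y] y1 pos[of True] by (intro divide_left_mono mult_pos_pos) auto
  then have "fst (lambda_bound False l r) / snd (lambda_bound False l r) \<le> cf x + cf ([0] \<frown> y)"
    using cf_between(1)[OF x] unfolding lambda_bound_eq(2)[OF l r] cf_0_conc[OF y(1)] by simp
  then show "fst (lambda_bound False l r) \<le> (cf x + cf ([0] \<frown> y)) * snd (lambda_bound False l r)"
    using lambda_bound_eq(1)[OF l r, of False] by (simp add: pos_divide_le_eq)
  have "1 / cf y \<le> 1 / (fst (cf_bound False l) / snd (cf_bound False l))"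
    using cf_between(1)[OF y] y1 pos[of False] by (intro divide_left_mono mult_pos_pos) auto
  then have "cf x + cf ([0] \<frown> y) \<le> fst (lambda_bound True l r) / snd (lambda_bound True l r)"
    using cf_between(2)[OF x] unfolding lambda_bound_eq(2)[OF l r] cf_0_conc[OF y(1)] by simp
  then show "(cf x + cf ([0] \<frown> y)) * snd (lambda_bound True l r) \<le> fst (lambda_bound True l r)"
    using lambda_bound_eq(1)[OF l r, of True] by (simp add: pos_le_divide_eq)
qed

text \<open>Cutting the same window at another index \<open>i\<close> moves the centre to position
  \<open>k\<close>. One window thus bounds \<open>lambda_at\<close> at each of its letters, and
  \<open>i = length l\<close> gives position 0.\<close>

lemma contains_starred_lambda_at:
  assumes "range \<theta> \<subseteq> {1, 2}" "contains_starred \<theta> l r" "i \<le> length (l @ r)"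
  defines "k \<equiv> int i - int (length l)" and "u \<equiv> rev (take i (l @ r))" and "v \<equiv> drop i (l @ r)"
  shows "fst (lambda_bound False u v) \<le> lambda_at k \<theta> * snd (lambda_bound False u v)"
    and "lambda_at k \<theta> * snd (lambda_bound True u v) \<le> fst (lambda_bound True u v)"
proof -
  have nth: "\<theta> (int j - int (length l)) = (l @ r) ! j" if "j < length (l @ r)" for j
    using assms(2) that unfolding contains_starred_def by blast
  have right: "\<theta> (k + int j) = v ! j" if "j < length v" for j
  proof -
    have "k + int j = int (i + j) - int (length l)" by (simp add: k_def)
    moreover have "i + j < length (l @ r)" using that by (simp add: v_def)
    ultimately have "\<theta> (k + int j) = (l @ r) ! (i + j)" using nth[of "i + j"] by (simp only:)
    also have "\<dots> = v ! j" using assms(3) by (simp add: v_def del: drop_append)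
    finally show ?thesis .
  qed
  have left: "\<theta> (k - 1 - int j) = u ! j" if "j < length u" for j
  proof -
    have j: "j < i" using that by (simp add: u_def)
    then have "k - 1 - int j = int (i - 1 - j) - int (length l)" by (simp add: k_def of_nat_diff)
    moreover have "i - 1 - j < length (l @ r)" using j assms(3) by simp
    ultimately have "\<theta> (k - 1 - int j) = (l @ r) ! (i - 1 - j)" using nth[of "i - 1 - j"] by (simp only:)
    also have "\<dots> = u ! j" using j assms(3) by (simp add: u_def rev_nth min_absorb2 del: take_append)
    finally show ?thesis .
  qed
  have "range (\<lambda>n. \<theta> (k + int n)) \<subseteq> {1, 2}" "range (\<lambda>n. \<theta> (k - 1 - int n)) \<subseteq> {1, 2}"
    using assms(1) by blast+
  from cf_sum_between[of "\<lambda>n. \<theta> (k + int n)" v "\<lambda>n. \<theta> (k - 1 - int n)" u, OF this(1) right this(2) left]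
  show "fst (lambda_bound False u v) \<le> lambda_at k \<theta> * snd (lambda_bound False u v)"
    and "lambda_at k \<theta> * snd (lambda_bound True u v) \<le> fst (lambda_bound True u v)"
    by (simp_all add: lambda_at_def)
qed

lemma lambda_at_0_le:
  assumes "range \<theta> \<subseteq> {1, 2}" "contains_starred \<theta> l r"
  shows "lambda_at 0 \<theta> * snd (lambda_bound True (rev l) r) \<le> fst (lambda_bound True (rev l) r)"
  using contains_starred_lambda_at(2)[OF assms, of "length l"] by simp

text \<open>A real \<open>SUP\<close> dominates its members only for a bounded family; here 3 + 1 =
  4 is a common bound.\<close>

lemma lambda_at_le_markov_value:
  assumes "range \<theta> \<subseteq> {1, 2}"
  shows "lambda_at i \<theta> \<le> markov_value \<theta>"
proof -
  have "lambda_at j \<theta> \<le> 4" for j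
  proof -
    have r: "range (\<lambda>n. \<theta> (j + int n)) \<subseteq> {1, 2}" "range (\<lambda>n. \<theta> (j - 1 - int n)) \<subseteq> {1, 2}"
      using assms by blast+
    have "cf (\<lambda>n. \<theta> (j + int n)) \<le> 3" "1 / cf (\<lambda>n. \<theta> (j - 1 - int n)) \<le> 1"
      using cf_bounds[OF r(1)] cf_bounds[OF r(2)] by simp_all
    then show ?thesis
      unfolding lambda_at_def cf_0_conc[OF r(2)] by simp
  qed
  then have "bdd_above (range (\<lambda>j. lambda_at j \<theta>))" by (auto intro: bdd_aboveI[where M = 4])
  then show ?thesis unfolding markov_value_def by (intro cSUP_upper) auto
qed

section \<open>Restricting, extending and realising windows\<close>

lemma contains_starred_sublists:
  assumes "contains_starred \<theta> (l' @ l) (r @ r')"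
  shows "contains_starred \<theta> l r"
  unfolding contains_starred_def
proof (intro allI impI)
  fix j assume j: "j < length (l @ r)"
  then have "\<theta> (int (length l' + j) - int (length (l' @ l))) = ((l' @ l) @ r @ r') ! (length l' + j)"
    using assms unfolding contains_starred_def by (auto simp del: of_nat_add)
  moreover have "((l' @ l) @ r @ r') ! (length l' + j) = (l @ r) ! j"
  proof -
    have "(l' @ l) @ r @ r' = l' @ (l @ r) @ r'" by simp
    then show ?thesis using j by (simp only: nth_append_length_plus nth_append[of "l @ r"] if_True)
  qed
  ultimately show "\<theta> (int j - int (length l)) = (l @ r) ! j" by simp
qed

lemma contains_starred_nth_right:
  assumes "contains_starred \<theta> l r" "j < length r"
  shows "\<theta> (int j) = r ! j"
  using assms(1)[unfolded contains_starred_def, rule_format, of "length l + j"] assms(2) by simp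

lemma contains_starred_nth_left:
  assumes "contains_starred \<theta> l r" "j < length l"
  shows "\<theta> (- 1 - int j) = rev l ! j"
proof -
  have "length l - Suc j < length l" using assms(2) by simp
  then show ?thesis
    using assms(1)[unfolded contains_starred_def, rule_format, of "length l - Suc j"] assms(2)
    by (simp add: nth_append rev_nth of_nat_diff algebra_simps)
qed

lemma contains_starred_snoc:
  assumes "contains_starred \<theta> l r"
  shows "contains_starred \<theta> l (r @ [\<theta> (int (length r))])"
  using assms unfolding contains_starred_def
  by (auto simp: nth_append less_Suc_eq)

lemma contains_starred_Cons:
  assumes "contains_starred \<theta> l r"
  shows "contains_starred \<theta> (\<theta> (- 1 - int (length l)) # l) r"
  using assms unfolding contains_starred_def
  by (auto simp: nth_Cons split: nat.split)

lemma contains_starred_exists: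
  assumes "set l \<subseteq> {1, 2}" "set r \<subseteq> {1, 2}"
  obtains \<theta> where "range \<theta> \<subseteq> {1, 2}" "contains_starred \<theta> l r"
proof
  let ?f = "\<lambda>i. if - int (length l) \<le> i \<and> i < int (length r)
    then (l @ r) ! nat (i + int (length l)) else 1"
  have "?f i \<in> {1, 2}" for i
  proof (cases "- int (length l) \<le> i \<and> i < int (length r)")
    case True
    then have "(l @ r) ! nat (i + int (length l)) \<in> set (l @ r)" by (intro nth_mem) auto
    then show ?thesis using assms True by auto
  qed auto
  then show "range ?f \<subseteq> {1, 2}" by blast
  show "contains_starred ?f l r" by (auto simp: contains_starred_def)
qed

lemma contains_starred_set:
  assumes "range \<theta> \<subseteq> {1, 2}" "contains_starred \<theta> l r"
  shows "set l \<subseteq> {1, 2}" "set r \<subseteq> {1, 2}"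
proof -
  have "(l @ r) ! j \<in> {1, 2}" if "j < length (l @ r)" for j
    using assms that unfolding contains_starred_def by (metis rangeI subsetD)
  then have "set (l @ r) \<subseteq> {1, 2}" by (metis in_set_conv_nth subsetI)
  then show "set l \<subseteq> {1, 2}" "set r \<subseteq> {1, 2}" by simp_all
qed

text \<open>The letters of \<open>\<theta>\<close> beyond the window serve as the two tails, so its
  value at 0 belongs to the set defining \<open>lambda0_minus\<close>. That set is bounded below by
  0, as the real \<open>Inf\<close> requires.\<close>

lemma lambda0_minus_le_lambda_at:
  assumes "range \<theta> \<subseteq> {1, 2}" "contains_starred \<theta> l r"
  shows "lambda0_minus l r \<le> lambda_at 0 \<theta>"
proof -
  let ?x = "\<lambda>n. \<theta> (int (n + length r))" and ?y = "\<lambda>n. \<theta> (- 1 - int (n + length l))"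
  let ?S = "{cf (r \<frown> \<theta>\<^sub>1) + cf ((0 # rev l) \<frown> \<theta>\<^sub>2) | \<theta>\<^sub>1 \<theta>\<^sub>2.
            range \<theta>\<^sub>1 \<subseteq> {1, 2} \<and> range \<theta>\<^sub>2 \<subseteq> {1, 2}}"
  have x: "r \<frown> ?x = (\<lambda>n. \<theta> (0 + int n))"
    using contains_starred_nth_right[OF assms(2)] by (auto simp: conc_def fun_eq_iff)
  have y: "rev l \<frown> ?y = (\<lambda>n. \<theta> (0 - 1 - int n))"
    using contains_starred_nth_left[OF assms(2)] by (auto simp: conc_def fun_eq_iff)
  have Cons: "(0 # rev l) \<frown> z = [0] \<frown> (rev l \<frown> z)" for z by simp
  note letters = contains_starred_set[OF assms]
  have "0 \<le> cf (r \<frown> z) + cf ((0 # rev l) \<frown> z')"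
    if "range z \<subseteq> {1, 2}" "range z' \<subseteq> {1, 2}" for z z'
  proof -
    have rng: "range (r \<frown> z) \<subseteq> {1, 2}" "range (rev l \<frown> z') \<subseteq> {1, 2}"
      using that letters by simp_all
    show ?thesis
      unfolding Cons cf_0_conc[OF rng(2)] using rng[THEN cf_bounds(1)] by simp
  qed
  then have "bdd_below ?S" by (intro bdd_belowI[where m = 0]) blast
  moreover have "lambda_at 0 \<theta> = cf (r \<frown> ?x) + cf ((0 # rev l) \<frown> ?y)"
    unfolding Cons x y lambda_at_def ..
  moreover have "range ?x \<subseteq> {1, 2}" "range ?y \<subseteq> {1, 2}" using assms(1) by blast+
  ultimately show ?thesis
    unfolding lambda0_minus_def by (intro cInf_lower) blast+
qed

section \<open>Bounds for the two thresholds\<close>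

text \<open>The scales are \<open>10 ^ 25\<close> and \<open>10 ^ 17\<close>: one window rejected from below misses the lower
  threshold by less than \<open>2 * 10 ^ -23\<close>.\<close>

definition omega_floor :: int where "omega_floor = 30000001423084628951577217"
definition lambda_ceiling :: int where "lambda_ceiling = 300000014230846469"

text \<open>A supremum is bounded below by its value at one position. Three periods give enough
  letters on both sides for the required precision.\<close>

lemma markov_value_omega_word: "omega_floor \<le> markov_value (periodic_word (omega_word 4)) * 10 ^ 25"
proof -
  let ?\<theta> = "periodic_word (omega_word 4)"
  let ?w = "omega_word 4 @ omega_word 4 @ omega_word 4"
  \<comment> \<open>Position \<open>43 = 33 + 10\<close> is the start of the block \<open>2\<^sub>9\<close> in the second period.\<close>
  define b where "b = lambda_bound False (rev (take 43 ?w)) (drop 43 ?w)"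
  have len: "length (omega_word 4) = 33" by (simp add: omega_word_def blocks_def)
  have "set (omega_word 4) \<subseteq> {1, 2}" by (auto simp: omega_word_def blocks_def)
  moreover have "?\<theta> i \<in> set (omega_word 4)" for i
    unfolding periodic_word_def using len by (intro nth_mem) (simp add: nat_less_iff)
  ultimately have rng: "range ?\<theta> \<subseteq> {1, 2}" by blast
  have "\<forall>j\<in>set [0..<length ?w]. ?\<theta> (int j) = ?w ! j" by code_simp
  then have cont: "contains_starred ?\<theta> [] ?w" by (auto simp: contains_starred_def)
  have b: "omega_floor * snd b \<le> fst b * 10 ^ 25" "0 < snd b"
    unfolding b_def by code_simp+
  have at_43: "fst b \<le> lambda_at 43 ?\<theta> * snd b"
    using contains_starred_lambda_at(1)[OF rng cont, of 43] len by (simp add: b_def)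
  have "omega_floor * real_of_int (snd b) \<le> fst b * 10 ^ 25"
    using b(1)[THEN of_int_le_iff[where ?'a = real, THEN iffD2]] by simp
  also have "\<dots> \<le> lambda_at 43 ?\<theta> * snd b * 10 ^ 25"
    using at_43 by simp
  also have "\<dots> \<le> markov_value ?\<theta> * snd b * 10 ^ 25"
    using lambda_at_le_markov_value[OF rng, of 43] b by simp
  finally show ?thesis using b by (simp add: mult.commute mult.left_commute)
qed

text \<open>An infimum lies below each of its members, so a single word through the window suffices.
  Its letters outside \<open>?l'\<close> and \<open>?r'\<close> are immaterial, because the cylinder
  bound covers all of them.\<close>

lemma lambda_tilde_4_upper: "lambda_tilde_4 * 10 ^ 17 \<le> lambda_ceiling"
proof -
  let ?l = "blocks [(2, 2), (1, 2), (2, 8), (1, 2), (2, 8), (1, 2)]"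
  let ?r = "blocks [(2, 1), (2, 8), (1, 2), (2, 10)]"
  \<comment> \<open>The added letters begin the tails \<open>\<theta>\<^sub>1\<close>, \<open>\<theta>\<^sub>2\<close> that minimise the value.\<close>
  let ?l' = "[1, 2, 1, 2] @ ?l" and ?r' = "?r @ [2, 1, 2, 1]"
  define b where "b = lambda_bound True (rev ?l') ?r'"
  obtain \<theta> where \<theta>: "range \<theta> \<subseteq> {1, 2}" "contains_starred \<theta> ?l' ?r'"
    by (rule contains_starred_exists[of ?l' ?r']) (auto simp: blocks_def)
  have b: "fst b * 10 ^ 17 \<le> lambda_ceiling * snd b" "0 < snd b"
    unfolding b_def by code_simp+
  have "lambda_tilde_4 \<le> lambda_at 0 \<theta>"
    unfolding lambda_tilde_4_def
    using lambda0_minus_le_lambda_at \<theta> contains_starred_sublists by blast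
  then have "lambda_tilde_4 * 10 ^ 17 * snd b \<le> lambda_at 0 \<theta> * 10 ^ 17 * snd b"
    using b by simp
  also have "\<dots> \<le> fst b * 10 ^ 17"
    using lambda_at_0_le[OF \<theta>, folded b_def] by simp
  also have "\<dots> \<le> real_of_int lambda_ceiling * snd b"
    using b(1)[THEN of_int_le_iff[where ?'a = real, THEN iffD2]] by simp
  finally show ?thesis using b by simp
qed

section \<open>The search tree\<close>

text \<open>A node carries a window \<open>(l, r)\<close> around position \<open>0\<close>. The leaves \<open>Low\<close> and \<open>High i\<close> are
  excluded because \<open>lambda_at\<close> is too small at position \<open>0\<close>, respectively too large at the
  letter \<open>(l @ r) ! i\<close>; \<open>Critical\<close> is the window defining \<open>lambda_tilde_4\<close>.\<close>

datatype search_tree =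
  Low | High nat | Critical | Goal | ExtL search_tree search_tree | ExtR search_tree search_tree

definition goal_left :: "nat list" where
  "goal_left = blocks [(2, 8), (1, 2), (2, 10), (1, 2), (2, 8), (1, 2)]"

definition goal_right :: "nat list" where
  "goal_right = blocks [(2, 1), (2, 8), (1, 2), (2, 10), (1, 2), (2, 8), (1, 2), (2, 2)]"

text \<open>The fractions are compared after cross-multiplication. Non-strict comparisons suffice at
  \<open>Low\<close> and \<open>High\<close>, since both inequalities of admissibility are
  strict.\<close>

fun valid_tree :: "search_tree \<Rightarrow> nat list \<Rightarrow> nat list \<Rightarrow> bool" where
  "valid_tree Low l r \<longleftrightarrow>
     (case lambda_bound True (rev l) r of (p, q) \<Rightarrow> p * 10 ^ 25 \<le> omega_floor * q)"
| "valid_tree (High i) l r \<longleftrightarrow> i \<le> length (l @ r) \<and>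
     (case lambda_bound False (rev (take i (l @ r))) (drop i (l @ r)) of
       (p, q) \<Rightarrow> lambda_ceiling * q \<le> p * 10 ^ 17)"
| "valid_tree Critical l r \<longleftrightarrow>
     l = blocks [(2, 2), (1, 2), (2, 8), (1, 2), (2, 8), (1, 2)] \<and>
     r = blocks [(2, 1), (2, 8), (1, 2), (2, 10)]"
| "valid_tree Goal l r \<longleftrightarrow> l = goal_left \<and> r = goal_right"
| "valid_tree (ExtL c d) l r \<longleftrightarrow> valid_tree c (1 # l) r \<and> valid_tree d (2 # l) r"
| "valid_tree (ExtR c d) l r \<longleftrightarrow> valid_tree c l (r @ [1]) \<and> valid_tree d l (r @ [2])"

lemma valid_treeI:
  "valid_tree c (1 # l) r \<Longrightarrow> valid_tree d (2 # l) r \<Longrightarrow> valid_tree (ExtL c d) l r"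
  "valid_tree c l (r @ [1]) \<Longrightarrow> valid_tree d l (r @ [2]) \<Longrightarrow> valid_tree (ExtR c d) l r"
  by simp_all

text \<open>The letters of \<open>\<theta>\<close> select a path through the tree: inner nodes split
  on the next letter, and every leaf other than \<open>Goal\<close> contradicts
  admissibility.\<close>

lemma valid_tree_sound:
  assumes "admissible 4 lambda_tilde_4 \<theta>" "contains_starred \<theta> l r" "valid_tree t l r"
  shows "contains_starred \<theta> goal_left goal_right"
  using assms(2,3)
proof (induction t arbitrary: l r)
  have rng: "range \<theta> \<subseteq> {1, 2}"
    and gt: "markov_value (periodic_word (omega_word 4)) < lambda_at 0 \<theta>"
    and lt: "lambda_at 0 \<theta> < lambda_tilde_4"
    and max: "markov_value \<theta> = lambda_at 0 \<theta>"
    using assms(1) by (simp_all add: admissible_def)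
  {
    case Low
    define b where "b = lambda_bound True (rev l) r"
    have pos: "0 < snd b"
      unfolding b_def
      using contains_starred_set[OF rng Low(1)] by (intro lambda_bound_eq) auto
    have floor: "fst b * 10 ^ 25 \<le> omega_floor * snd b"
      using Low(2) by (simp add: split_beta b_def)
    have "omega_floor < lambda_at 0 \<theta> * 10 ^ 25"
      using gt markov_value_omega_word by simp
    then have "omega_floor * snd b < lambda_at 0 \<theta> * 10 ^ 25 * snd b"
      using pos by simp
    also have "\<dots> \<le> fst b * 10 ^ 25"
      using lambda_at_0_le[OF rng Low(1), folded b_def] by simp
    also have "\<dots> \<le> real_of_int omega_floor * snd b"
      using floor[THEN of_int_le_iff[where ?'a = real, THEN iffD2]] by simp
    finally show ?case by simp
  next
    case (High i)
    define b where "b = lambda_bound False (rev (take i (l @ r))) (drop i (l @ r))"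
    let ?k = "int i - int (length l)"
    have i: "i \<le> length (l @ r)" and ceiling: "lambda_ceiling * snd b \<le> fst b * 10 ^ 17"
      using High(2) by (simp_all add: split_beta b_def)
    have "set (take i (l @ r)) \<subseteq> set (l @ r)" "set (drop i (l @ r)) \<subseteq> set (l @ r)"
      by (rule set_take_subset set_drop_subset)+
    then have pos: "0 < snd b"
      unfolding b_def
      using contains_starred_set[OF rng High(1)] by (intro lambda_bound_eq) auto
    \<comment> \<open>The Markov value is attained at 0, so the upper threshold applies at every
      position.\<close>
    have "lambda_at ?k \<theta> < lambda_tilde_4"
      using lambda_at_le_markov_value[OF rng, of ?k] max lt by simp
    then have "lambda_at ?k \<theta> * 10 ^ 17 < lambda_ceiling"
      using lambda_tilde_4_upper by simp
    then have "lambda_at ?k \<theta> * 10 ^ 17 * snd b < lambda_ceiling * real_of_int (snd b)"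
      using pos by simp
    also have "\<dots> \<le> fst b * 10 ^ 17"
      using ceiling[THEN of_int_le_iff[where ?'a = real, THEN iffD2]] by simp
    also have "\<dots> \<le> lambda_at ?k \<theta> * 10 ^ 17 * snd b"
      using contains_starred_lambda_at(1)[OF rng High(1) i, folded b_def] by simp
    finally show ?case by simp
  next
    case Critical
    then have "lambda_tilde_4 \<le> lambda_at 0 \<theta>"
      unfolding lambda_tilde_4_def by (auto intro: lambda0_minus_le_lambda_at[OF rng])
    then show ?case using lt by simp
  next
    case Goal
    then show ?case by simp
  next
    case (ExtL c d)
    have "\<theta> (- 1 - int (length l)) \<in> {1, 2}" using rng by blast
    then show ?case
      using contains_starred_Cons[OF ExtL.prems(1)] ExtL.IH ExtL.prems(2) by auto
  next
    case (ExtR c d)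
    have "\<theta> (int (length r)) \<in> {1, 2}" using rng by blast
    then show ?case
      using contains_starred_snoc[OF ExtR.prems(1)] ExtR.IH ExtR.prems(2) by auto
  }
qed

text \<open>The tree was found by computer, extending at each node on the side that leaves the
  fewest open nodes a few levels below.\<close>

definition main_tree :: search_tree where
  "main_tree =
   ExtL (ExtL (ExtR (ExtR (ExtL (ExtL (ExtR (ExtR (ExtL (ExtL (ExtR (ExtR (ExtL (ExtL (ExtR
    (ExtR (ExtL (ExtL (ExtR (ExtR (ExtL (ExtL (ExtR (ExtR (ExtL (ExtL (ExtR (ExtR (ExtL Low
    (ExtL (High 1) (ExtR (ExtR Low Low) (High 17)))) Low) (ExtL (High 16) (High 16))) (ExtR Low
    (ExtR Low Low))) (High 14)) (High 14)) (High 13)) (ExtR Low (ExtL (High 1) (ExtR (High 26)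
    (ExtL Low Low))))) (High 12)) (High 12)) (High 11)) (ExtR Low (ExtL (High 1) (ExtR (High 12)
    (ExtL (ExtR (ExtL (ExtR (ExtL Low Low) Low) (High 2)) (High 13)) (High 2)))))) (High 10))
    (High 10)) (High 9)) (ExtR Low (ExtL (High 1) (ExtR (High 10) (ExtL (ExtR (ExtL (ExtR (ExtL
    (ExtR (ExtL (ExtR (ExtL Low Low) Low) (High 4)) (High 13)) (High 4)) Low) (High 2)) (High
    11)) (High 2)))))) (High 8)) (High 8)) (High 7)) (ExtR Low (ExtL (High 1) (ExtR (High 8)
    (ExtL (ExtR (ExtL (ExtR (ExtL (ExtR (ExtL (ExtR (ExtL (ExtR (ExtL (ExtR (ExtL Low Low) Low)
    (High 6)) (High 13)) (ExtR Low (ExtR (High 25) Low))) Low) (High 4)) (High 11)) (High 4))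
    Low) (High 2)) (High 9)) (High 2)))))) (High 6)) (High 6)) (High 5)) (ExtR Low (ExtL (High
    1) (ExtR (High 6) (ExtL (ExtR (ExtL (ExtR (ExtL (ExtR (ExtL (ExtR (ExtR (High 15) (ExtL
    (High 11) (ExtL (High 1) (ExtR (High 12) (ExtL (ExtR Low (High 23)) Low))))) Low) (High 4))
    (High 9)) (ExtR Low (ExtL (High 5) (ExtR (High 10) (ExtL (ExtR (ExtL (ExtR (ExtL (ExtR Low
    (ExtL (ExtR (High 26) Low) (High 4))) Low) Low) (High 2)) (High 11)) (High 6)))))) Low)
    (High 2)) (High 7)) (High 2)))))) (High 4)) (High 4)) (High 3)) (ExtR Low (ExtL (High 1)
    (ExtR (High 4) (ExtL (ExtR (ExtL (ExtR (ExtR (High 9) (ExtL (High 7) (ExtL (High 1) (ExtR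
    (High 8) (ExtL (ExtR (ExtL (ExtR (ExtR (High 13) (ExtL (High 11) (ExtR (High 21) Low))) Low)
    (High 2)) (High 9)) (ExtR Low (ExtL (High 3) (ExtR (High 10) (ExtL (ExtL (ExtR Low (ExtR
    (High 18) (ExtL Low Low))) (High 2)) Low))))))))) Low) (High 2)) (High 5)) (ExtR Low (ExtL
    (High 3) (ExtR (High 6) (ExtL (ExtR (ExtL (ExtR (ExtL (High 3) (ExtR Low (ExtL (High 1)
    (ExtR (High 10) (ExtL (ExtR (High 16) (ExtL (ExtR (High 20) (ExtL Low Low)) (High 12)))
    Low))))) Low) (High 2)) (High 7)) (ExtR Low (ExtL (High 5) (ExtR (High 8) (ExtL (ExtR (ExtL
    (ExtR (ExtL (High 3) Low) Low) (High 2)) (High 9)) (ExtR Low (ExtL (High 7) (ExtR (ExtR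
    (ExtR (High 18) (ExtL (ExtL (ExtL (High 3) (ExtR Low (ExtL (High 1) (ExtR (High 14) (ExtL
    (High 5) (ExtR Low (ExtL (High 3) (ExtR (High 16) (ExtL (High 7) (ExtR Low (ExtL (High 5)
    (ExtR (High 18) (ExtR (High 29) (ExtL (High 19) (ExtL (High 7) (ExtR (High 20) (ExtL (ExtL
    (ExtL (High 3) (ExtL (High 1) (ExtR (ExtR Low Low) Critical))) (High 2)) (ExtR Low (ExtR
    (ExtR (ExtL Low (ExtR (High 42) (ExtL (ExtL (ExtL (High 3) (ExtR Low (ExtL (High 1) (ExtR
    (High 46) (ExtL (High 5) (ExtR Low (ExtL (High 3) (ExtR (High 48) (ExtL (High 7) (ExtR Low
    (ExtL (High 5) (ExtR (High 50) (ExtL (High 9) (ExtR Low (ExtL (High 7) (ExtR (ExtR (ExtR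
    (High 62) (ExtR (High 65) Goal)) (High 62)) Low)))))))))))))))) (High 2)) Low))) (High 41))
    Low))))))))))))))))))) (High 12)) Low)) (High 10)) Low)))))))))))))))) (High 2)"

text \<open>Descending to the leaves by resolution keeps \<open>code_simp\<close> from renormalising the
  remaining subtree at every node.\<close>

lemma valid_main_tree: "valid_tree main_tree [1] [2, 2]"
  unfolding main_tree_def by (intro valid_treeI; code_simp)

section \<open>Transposition\<close>

lemma lambda_at_transposition:
  assumes "range \<theta> \<subseteq> {1, 2}"
  shows "lambda_at i (transposition \<theta>) = lambda_at (- i) \<theta>"
proof -
  \<comment> \<open>In \<open>lambda_at\<close> the central letter belongs to the right half;
    splitting it off makes the two sides interchangeable.\<close>
  have symmetric_form: "lambda_at i \<eta> =
      real (\<eta> i) + 1 / cf (\<lambda>n. \<eta> (i + 1 + int n)) + 1 / cf (\<lambda>n. \<eta> (i - 1 - int n))"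
    if "range \<eta> \<subseteq> {1, 2}" for i and \<eta> :: "int \<Rightarrow> nat"
  proof -
    have "range (\<lambda>n. \<eta> (i + int (Suc n))) \<subseteq> {1, 2}" "range (\<lambda>n. \<eta> (i - 1 - int n)) \<subseteq> {1, 2}"
      using that by blast+
    from cf_unfold[of "\<lambda>n. \<eta> (i + int n)", OF this(1)] cf_0_conc[OF this(2)] show ?thesis
      unfolding lambda_at_def by (simp add: add.assoc)
  qed
  have "range (transposition \<theta>) \<subseteq> {1, 2}"
    using assms by (auto simp: transposition_def)
  from symmetric_form[OF this] symmetric_form[OF assms] show ?thesis
    by (simp add: transposition_def algebra_simps)
qed

text \<open>Reflection permutes the values over all positions, which preserves their supremum, and
  fixes position 0.\<close>

lemma admissible_transposition:
  assumes "admissible k \<Lambda> \<theta>"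
  shows "admissible k \<Lambda> (transposition \<theta>)"
proof -
  have rng: "range \<theta> \<subseteq> {1, 2}" using assms by (simp add: admissible_def)
  have "range (\<lambda>i. lambda_at i (transposition \<theta>)) = range (\<lambda>i. lambda_at i \<theta>)"
    using image_image[of "\<lambda>i. lambda_at i \<theta>" uminus UNIV]
    by (simp add: lambda_at_transposition[OF rng])
  then have "markov_value (transposition \<theta>) = markov_value \<theta>"
    by (simp add: markov_value_def)
  moreover have "range (transposition \<theta>) \<subseteq> {1, 2}"
    using rng by (auto simp: transposition_def)
  ultimately show ?thesis
    using assms by (simp add: admissible_def lambda_at_transposition[OF rng])
qed

section \<open>Case analysis on the letters at positions -1, 0 and 1\<close>

theorem lemma7p20:
  fixes \<theta> :: "int \<Rightarrow> nat"
  assumes "admissible 4 lambda_tilde_4 \<theta>"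
  shows "\<exists>\<eta> \<in> {\<theta>, transposition \<theta>}.
    contains_starred \<eta>
      (blocks [(2, 8), (1, 2), (2, 10), (1, 2), (2, 8), (1, 2)])
      (blocks [(2, 1), (2, 8), (1, 2), (2, 10), (1, 2), (2, 8), (1, 2), (2, 2)]) \<and>
    contains_starred \<eta>
      (blocks [(2, 8), (1, 2), (2, 10), (1, 2), (2, 8), (1, 2)])
      (blocks [(2, 1), (2, 8), (1, 2), (2, 10), (1, 2), (2, 8), (1, 1)])"
proof -
  have main: "contains_starred \<eta> goal_left goal_right"
    if "admissible 4 lambda_tilde_4 \<eta>" "\<eta> (- 1) = 1" "\<eta> 0 = 2" "\<eta> 1 = 2" for \<eta>
  proof (rule valid_tree_sound[OF that(1) _ valid_main_tree])
    show "contains_starred \<eta> [1] [2, 2]"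
      using that(2-4) by (auto simp: contains_starred_def All_less_Suc)
  qed
  have "range \<theta> \<subseteq> {1, 2}" using assms by (simp add: admissible_def)
  then have "\<theta> (- 1) \<in> {1, 2}" "\<theta> 0 \<in> {1, 2}" "\<theta> 1 \<in> {1, 2}" by blast+
  \<comment> \<open>A central 1, or a central 2 between two 2s, is too small; a central 2 between
    two 1s is too large. The two remaining patterns are mirror images.\<close>
  then consider "\<theta> 0 = 1" | "\<theta> (- 1) = 1" "\<theta> 0 = 2" "\<theta> 1 = 1" | "\<theta> (- 1) = 2" "\<theta> 0 = 2" "\<theta> 1 = 2"
    | "\<theta> (- 1) = 1" "\<theta> 0 = 2" "\<theta> 1 = 2" | "\<theta> (- 1) = 2" "\<theta> 0 = 2" "\<theta> 1 = 1"
    by blast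
  then have "\<exists>\<eta> \<in> {\<theta>, transposition \<theta>}. contains_starred \<eta> goal_left goal_right"
  proof cases
    case 1
    then have "contains_starred \<theta> [] [1]" by (simp add: contains_starred_def)
    moreover have "valid_tree Low [] [1]" by code_simp
    ultimately show ?thesis using valid_tree_sound[OF assms] by blast
  next
    case 2
    then have "contains_starred \<theta> [1] [2, 1]"
      by (auto simp: contains_starred_def All_less_Suc)
    \<comment> \<open>The three letters alone give only the lower bound 5/2 + 1/2 = 3, so one more
      letter is read on the left; position 0 then has index 2.\<close>
    moreover have "valid_tree (ExtL (High 2) (High 2)) [1] [2, 1]" by code_simp
    ultimately show ?thesis using valid_tree_sound[OF assms] by blast
  next
    case 3
    then have "contains_starred \<theta> [2] [2, 2]"
      by (auto simp: contains_starred_def All_less_Suc)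
    moreover have "valid_tree Low [2] [2, 2]" by code_simp
    ultimately show ?thesis using valid_tree_sound[OF assms] by blast
  next
    case 4
    then show ?thesis using main[OF assms] by blast
  next
    case 5
    then have "contains_starred (transposition \<theta>) goal_left goal_right"
      by (intro main admissible_transposition assms) (simp_all add: transposition_def)
    then show ?thesis by blast
  qed
  \<comment> \<open>The second window drops the last three letters 1, 2, 2 of the first.\<close>
  moreover have prefix: "goal_right =
      blocks [(2, 1), (2, 8), (1, 2), (2, 10), (1, 2), (2, 8), (1, 1)] @ blocks [(1, 1), (2, 2)]"
    by code_simp
  have "contains_starred \<eta> goal_left
      (blocks [(2, 1), (2, 8), (1, 2), (2, 10), (1, 2), (2, 8), (1, 1)])"
    if "contains_starred \<eta> goal_left goal_right" for \<eta>
    by (rule contains_starred_sublists[of \<eta> "[]" goal_left _ "blocks [(1, 1), (2, 2)]"])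
      (simp only: append_Nil prefix[symmetric] that)
  ultimately show ?thesis
    unfolding goal_left_def goal_right_def by blast
qed

end
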